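(* Let $G$ be a finitely generated group with product shrinkage at most $f$, where $f:\mathbb N\to[1,\infty)$ is non-decreasing and satisfies $$\sum_{n=1}^\infty\frac{\log f(n)}{n^2}<\infty.$$ Then, for every non-empty approximate semigroup $A\subseteq G$, the limit $$\lim_{n\to\infty}\frac1n\log|A\cap B_n|$$ exists in $\mathbb R$.
   Context: $G$ is equipped with a fixed finite generating set, $B_n$ denotes the ball of radius $n$ around the identity in the corresponding word metric, and $UV=\{uv:u\in U,v\in V\}$ for $U,V\subseteq G$. For a non-decreasing function $f:\mathbb N\to[1,\infty)$, the group $G$ has product shrinkage at most $f$ if for all $n,k$ and all finite subsets $U\subseteq B_n$ and $V\subseteq B_k$, $|UV|\ge\frac{|U|\,|V|}{f(n+k)}$. A subset $A\subseteq G$ is an approximate semigroup if there is a finite subset $X\subseteq G$ such that $A^2\subseteq AX$, where $A^2=AA$. *)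

theory Defs
  imports "HOL-Algebra.Generated_Groups" Complex_Main
begin

text \<open>
  For a generating set \<open>S\<close>, words are lists over the letters \<open>S \<union> m_inv G ` S\<close>; \<open>S\<close> itself is not assumed
  to be symmetric or to contain the identity. The word length is only meaningful for elements of
  the subgroup generated by \<open>S\<close>, since otherwise the \<open>LEAST\<close> ranges over an empty set.
\<close>

definition word_length :: "('a, 'b) monoid_scheme \<Rightarrow> 'a set \<Rightarrow> 'a \<Rightarrow> nat" where
  "word_length G S g =
     (LEAST n. \<exists>ws. length ws = n \<and> set ws \<subseteq> S \<union> m_inv G ` S \<and> g = foldr (mult G) ws (one G))"

definition word_dist :: "('a, 'b) monoid_scheme \<Rightarrow> 'a set \<Rightarrow> 'a \<Rightarrow> 'a \<Rightarrow> nat" where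
  "word_dist G S g h = word_length G S (m_inv G g \<otimes>\<^bsub>G\<^esub> h)"

definition word_ball :: "('a, 'b) monoid_scheme \<Rightarrow> 'a set \<Rightarrow> nat \<Rightarrow> 'a set" where
  "word_ball G S n = {g \<in> carrier G. word_dist G S \<one>\<^bsub>G\<^esub> g \<le> n}"

definition product_shrinkage_at_most ::
    "('a, 'b) monoid_scheme \<Rightarrow> 'a set \<Rightarrow> (nat \<Rightarrow> real) \<Rightarrow> bool" where
  "product_shrinkage_at_most G S f \<longleftrightarrow>
     (\<forall>n k U V. finite U \<longrightarrow> finite V \<longrightarrow> U \<subseteq> word_ball G S n \<longrightarrow> V \<subseteq> word_ball G S k \<longrightarrow>
        real (card (U <#>\<^bsub>G\<^esub> V)) \<ge> real (card U) * real (card V) / f (n + k))"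

definition approximate_semigroup :: "('a, 'b) monoid_scheme \<Rightarrow> 'a set \<Rightarrow> bool" where
  "approximate_semigroup G A \<longleftrightarrow>
     A \<subseteq> carrier G \<and> (\<exists>X. finite X \<and> X \<subseteq> carrier G \<and> A <#>\<^bsub>G\<^esub> A \<subseteq> A <#>\<^bsub>G\<^esub> X)"

end

theory Submission
  imports Defs "HOL-Analysis.Summation_Tests"
begin

text \<open>
  Put \<open>b n = ln |A \<inter> B\<^sub>n|\<close> and let \<open>X\<close> be a finite set with \<open>A\<^sup>2 \<subseteq> A X\<close>, with the inverses of its
  elements in \<open>B\<^sub>c\<close>. An element of \<open>(A \<inter> B\<^sub>n) (A \<inter> B\<^sub>k)\<close> has the form \<open>a x\<close> with \<open>a \<in> A\<close> and
  \<open>x \<in> X\<close>; multiplying by \<open>x\<^sup>-\<^sup>1\<close> shows that \<open>a\<close> lies in \<open>B\<close> of radius \<open>n + k + c\<close>. So the product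
  set has at most \<open>|X|\<close> times as many elements as \<open>A\<close> has in that ball (\<open>card_product_le\<close>), while
  the shrinkage bound says that it is almost as large as \<open>|A \<inter> B\<^sub>n| |A \<inter> B\<^sub>k|\<close>. Taking
  logarithms, \<open>b n + b k \<le> b (n + k + c) + ln |X| + ln (f (n + k))\<close>, and the delayed sequence
  \<open>d n = b (n - c)\<close> is superadditive up to the error \<open>g n = ln |X| + ln (f n)\<close>, with
  \<open>\<Sum> g n / n\<^sup>2 < \<infinity>\<close>.

  By the theorem of de Bruijn and Erdos, such a sequence has a limit of \<open>d n / n\<close>. Here \<open>d\<close> is
  also monotone, nonnegative and at most linear, which permits a short proof. Build \<open>qN\<close> by
  repeated halving of \<open>q\<close>; near scale \<open>r\<close> there are about \<open>qN / r\<close> splittings, each costing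
  about \<open>g r\<close>, so the total loss is \<open>qN\<close> times a sum of \<open>g r / r\<close> over dyadic scales \<open>r \<ge> N\<close>.
  This is bounded by a tail of \<open>\<Sum> g m / m\<^sup>2\<close> (\<open>multiple_lower_bound\<close>). Hence every value
  \<open>d N / N\<close> is, up to an error vanishing as \<open>N \<rightarrow> \<infinity>\<close>, an eventual lower bound for \<open>d m / m\<close>.
\<close>

section \<open>Almost superadditive sequences\<close>

text \<open>
  The error of the splitting \<open>q = \<lfloor>q/2\<rfloor> + \<lceil>q/2\<rceil>\<close> is paid for by the part of the sum by which the
  bound for \<open>q\<close> exceeds the one for \<open>\<lceil>q/2\<rceil>\<close>. The range of summation ends at \<open>2qN\<close>, not \<open>qN\<close>, so
  that this part lies beyond \<open>qN\<close>, where \<open>g\<close> is at least \<open>g (q * N)\<close> by monotonicity.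
\<close>

lemma multiple_lower_bound:
  fixes d g :: "nat \<Rightarrow> real"
  assumes g: "mono g" "\<And>n. 0 \<le> g n" and N: "0 < N"
    and super: "\<And>p q. N \<le> p \<Longrightarrow> N \<le> q \<Longrightarrow> d p + d q \<le> d (p + q) + g (p + q)"
    and q: "0 < q"
  shows "q * d N \<le> d (q * N) + 8 * (real q * real N) * (\<Sum>m\<in>{2*N<..2*q*N}. g m / (real m)\<^sup>2)"
  using q
proof (induction q rule: less_induct)
  case (less q)
  define s where "s q = (\<Sum>m\<in>{2*N<..2*q*N}. g m / (real m)\<^sup>2)" for q
  show ?case
  proof (cases "q = 1")
    case True
    then show ?thesis by simp
  next
    case False
    define a b where "a = q div 2" and "b = q - q div 2"
    have ab: "0 < a" "a \<le> b" "b < q" "q = a + b" "q \<le> 2 * b" "q \<le> 4 * a"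
      using False less.prems by (auto simp: a_def b_def)
    have IHa: "a * d N \<le> d (a * N) + 8 * (real a * real N) * s a"
      using less.IH[of a] ab by (simp add: s_def)
    have IHb: "b * d N \<le> d (b * N) + 8 * (real b * real N) * s b"
      using less.IH[of b] ab by (simp add: s_def)
    have "s a \<le> s b"
      unfolding s_def
    proof (rule sum_mono2)
      show "{2*N<..2*a*N} \<subseteq> {2*N<..2*b*N}"
      proof
        fix m assume m: "m \<in> {2*N<..2*a*N}"
        then have "m \<le> 2*a*N" by simp
        also have "\<dots> \<le> 2*b*N" using ab by (intro mult_le_mono1) simp
        finally show "m \<in> {2*N<..2*b*N}" using m by simp
      qed
    qed (auto simp: g(2))
    then have "8 * (real a * real N) * s a \<le> 8 * (real a * real N) * s b"
      by (intro mult_left_mono) auto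
    moreover have "d (a * N) + d (b * N) \<le> d (q * N) + g (q * N)"
      using super[of "a * N" "b * N"] ab by (simp add: distrib_right)
    ultimately have *: "q * d N \<le> d (q * N) + g (q * N) + 8 * (real q * real N) * s b"
      using IHa IHb ab(4) by (simp add: algebra_simps)
    define T where "T = (\<Sum>m\<in>{2*b*N<..2*q*N}. g m / (real m)\<^sup>2)"
    have split: "s q = s b + T"
    proof -
      have "2*N \<le> 2*b*N" "2*b*N \<le> 2*q*N" using ab by (auto intro: mult_le_mono1)
      then have "{2*N<..2*q*N} = {2*N<..2*b*N} \<union> {2*b*N<..2*q*N}"
        by (rule ivl_disj_un_two(6)[symmetric])
      then show ?thesis
        unfolding s_def T_def by (simp add: sum.union_disjoint ivl_disj_int)
    qed
    \<comment> \<open>The summands with index above \<open>2bN \<ge> qN\<close> are where \<open>g\<close> dominates the error \<open>g (q * N)\<close>,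
      and at least \<open>qN / 2\<close> of them are available.\<close>
    have "g (q * N) / (2 * q * N)\<^sup>2 \<le> g m / (real m)\<^sup>2" if "m \<in> {2*b*N<..2*q*N}" for m
    proof -
      have "q * N \<le> 2 * b * N" using ab by simp
      also have "\<dots> \<le> m" using that by simp
      finally have "q * N \<le> m" .
      then have "g (q * N) \<le> g m" using g(1) by (rule monoD[rotated])
      moreover have "real m \<le> 2 * q * N" using that by (subst of_nat_le_iff) simp
      moreover have "0 < m" using that by auto
      ultimately show ?thesis
        using g(2) by (intro frac_le power_mono) auto
    qed
    then have "real (card {2*b*N<..2*q*N}) * (g (q * N) / (2 * q * N)\<^sup>2) \<le> T"
      unfolding T_def by (intro sum_bounded_below) auto
    moreover have "card {2*b*N<..2*q*N} = 2 * a * N"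
      using ab by (simp add: algebra_simps)
    ultimately have T: "real (2 * a * N) * (g (q * N) / (2 * q * N)\<^sup>2) \<le> T"
      by simp
    have "g (q * N) * q \<le> g (q * N) * (4 * a)"
      using ab g(2) by (intro mult_left_mono) auto
    then have "g (q * N) \<le> 8 * (real q * real N) * (real (2 * a * N) * (g (q * N) / (2 * q * N)\<^sup>2))"
      using N less.prems by (simp add: field_simps power2_eq_square)
    also have "\<dots> \<le> 8 * (real q * real N) * T"
      using T by (intro mult_left_mono) auto
    finally have "q * d N \<le> d (q * N) + 8 * (real q * real N) * s q"
      using * by (simp add: split algebra_simps)
    then show ?thesis by (simp add: s_def)
  qed
qed

text \<open>
  The de Bruijn--Erdos extension of Fekete's lemma, for monotone sequences of at most linear
  growth. With \<open>t N\<close> the tail of the error series, \<open>y N = d N / N - 8 * t N\<close> bounds \<open>d m / m\<close>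
  from below along multiples of \<open>N\<close>, and by monotonicity of \<open>d\<close> asymptotically for all \<open>m\<close>.
  Since \<open>d m / m\<close> itself exceeds \<open>y m\<close> only by \<open>8 * t m\<close>, which tends to \<open>0\<close>, it converges to
  the supremum of the \<open>y N\<close>.
\<close>

theorem almost_superadditive_convergent:
  fixes d g :: "nat \<Rightarrow> real" and C :: real
  assumes d: "mono d" "\<And>n. 0 \<le> d n" "\<And>n. d n \<le> C * n"
    and g: "mono g" "\<And>n. 0 \<le> g n" "summable (\<lambda>n. g n / (real n)\<^sup>2)"
    and super: "\<And>p q. n0 \<le> p \<Longrightarrow> n0 \<le> q \<Longrightarrow> d p + d q \<le> d (p + q) + g (p + q)"
  shows "convergent (\<lambda>n. d n / n)"
proof -
  define h where "h n = g n / (real n)\<^sup>2" for n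
  define t where "t N = (\<Sum>i. h (i + N))" for N
  have h0: "0 \<le> h n" for n using g(2) by (simp add: h_def)
  have sh: "summable (\<lambda>i. h (i + N))" for N
    using g(3) by (simp add: h_def[symmetric] summable_iff_shift)
  have t0: "0 \<le> t N" for N
    unfolding t_def by (intro suminf_nonneg sh h0)
  have t_lim: "t \<longlonglongrightarrow> 0"
  proof (rule LIMSEQ_I)
    fix r :: real assume "0 < r"
    then show "\<exists>no. \<forall>n\<ge>no. norm (t n - 0) < r"
      using suminf_exist_split[OF \<open>0 < r\<close> sh[of 0, simplified]] by (simp add: t_def)
  qed
  define y where "y N = d N / N - 8 * t N" for N
  have multiple: "y N * (real q * real N) \<le> d (q * N)" if N: "n0 \<le> N" "0 < N" and "0 < q" for N q
  proof -
    have "q * d N \<le> d (q * N) + 8 * (real q * real N) * (\<Sum>m\<in>{2*N<..2*q*N}. h m)"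
      unfolding h_def using N \<open>0 < q\<close>
      by (intro multiple_lower_bound g(1,2)) (auto intro!: super)
    moreover have "(\<Sum>m\<in>{2*N<..2*q*N}. h m) \<le> t N"
    proof -
      have "(\<Sum>m\<in>{2*N<..2*q*N}. h m) = (\<Sum>i\<in>{N<..2*q*N - N}. h (i + N))"
        by (rule sum.reindex_bij_witness[of _ "\<lambda>i. i + N" "\<lambda>m. m - N"]) auto
      also have "\<dots> \<le> t N"
        unfolding t_def by (intro sum_le_suminf sh) (auto simp: h0)
      finally show ?thesis .
    qed
    then have "8 * (real q * real N) * (\<Sum>m\<in>{2*N<..2*q*N}. h m) \<le> 8 * (real q * real N) * t N"
      by (intro mult_left_mono) auto
    ultimately have "q * d N \<le> d (q * N) + 8 * (real q * real N) * t N" by linarith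
    moreover have "y N * (real q * real N) = q * d N - 8 * (real q * real N) * t N"
      using N by (simp add: y_def field_simps)
    ultimately show ?thesis by simp
  qed
  have eventually_ge: "\<forall>\<^sub>F m in sequentially. y N - e < d m / m" if N: "n0 \<le> N" "0 < N" and e: "0 < e" for N e
  proof -
    \<comment> \<open>Rounding \<open>m\<close> down to a multiple of \<open>N\<close> costs at most \<open>\<bar>y N\<bar> * N\<close>, which is below \<open>e * m\<close>
      as soon as \<open>m\<close> exceeds \<open>M\<close>.\<close>
    define M where "M = \<bar>y N\<bar> * N / e"
    have "\<forall>\<^sub>F m in sequentially. M < real m"
      using filterlim_real_sequentially by (simp add: filterlim_at_top_dense)
    then show ?thesis using eventually_ge_at_top[of N]
    proof eventually_elim
      case (elim m)
      define q where "q = m div N"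
      have q: "0 < q" "q * N \<le> m" "m < q * N + N"
        using elim N by (auto simp: q_def div_greater_zero_iff dividend_less_div_times add.commute)
      have "real m - N \<le> real (q * N)" "real (q * N) \<le> m" using q by linarith+
      then have "\<bar>y N\<bar> * (m - real (q * N)) \<le> \<bar>y N\<bar> * N"
        by (intro mult_left_mono) auto
      moreover have "y N * (m - real (q * N)) \<le> \<bar>y N\<bar> * (m - real (q * N))"
        using q by (intro mult_right_mono) (auto simp del: of_nat_mult)
      ultimately have "y N * m - \<bar>y N\<bar> * N \<le> y N * (real q * real N)"
        by (simp add: algebra_simps)
      also have "\<dots> \<le> d (q * N)" by (rule multiple[OF N q(1)])
      also have "\<dots> \<le> d m" using d(1) q(2) by (rule monoD)
      finally have "y N * m - \<bar>y N\<bar> * N \<le> d m" .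
      moreover have "\<bar>y N\<bar> * N < e * m" using elim(1) e by (simp add: M_def field_simps)
      ultimately have "(y N - e) * m < d m" by (simp add: algebra_simps)
      then show ?case using elim N by (simp add: field_simps)
    qed
  qed
  define Y where "Y = y ` {max 1 n0..}"
  have y_le: "y N \<le> C" if "0 < N" for N
  proof -
    have "d N / N \<le> C" using d(3)[of N] that by (simp add: divide_le_eq)
    then show ?thesis using t0[of N] by (simp add: y_def)
  qed
  have bdd: "bdd_above Y" unfolding Y_def by (intro bdd_aboveI[of _ C]) (auto intro: y_le)
  have "(\<lambda>n. d n / n) \<longlonglongrightarrow> Sup Y"
  proof (rule order_tendstoI)
    fix a assume "a < Sup Y"
    then obtain N where N: "n0 \<le> N" "0 < N" "a < y N"
      using less_cSup_iff[OF _ bdd] by (auto simp: Y_def)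
    then have "\<forall>\<^sub>F m in sequentially. y N - (y N - a) < d m / m"
      by (intro eventually_ge) auto
    then show "\<forall>\<^sub>F m in sequentially. a < d m / m" by simp
  next
    fix a assume a: "Sup Y < a"
    have "(\<lambda>n. Sup Y + 8 * t n) \<longlonglongrightarrow> Sup Y + 8 * 0"
      by (intro tendsto_intros t_lim)
    then have "\<forall>\<^sub>F n in sequentially. Sup Y + 8 * t n < a"
      using a by (intro order_tendstoD) auto
    then show "\<forall>\<^sub>F n in sequentially. d n / n < a"
      using eventually_ge_at_top[of "max 1 n0"]
    proof eventually_elim
      case (elim n)
      then have "y n \<le> Sup Y" by (intro cSup_upper bdd) (auto simp: Y_def)
      then show ?case using elim by (simp add: y_def)
    qed
  qed
  then show ?thesis by (rule convergentI)
qed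

section \<open>Balls in the word metric\<close>

definition words :: "('a, 'b) monoid_scheme \<Rightarrow> 'a set \<Rightarrow> nat \<Rightarrow> 'a list set" where
  "words G S n = {ws. set ws \<subseteq> S \<union> m_inv G ` S \<and> length ws \<le> n}"

context group
begin

lemma foldr_mult_closed: "set ws \<subseteq> carrier G \<Longrightarrow> foldr (\<otimes>) ws \<one> \<in> carrier G"
  by (induction ws) auto

lemma foldr_mult_append:
  "set us \<subseteq> carrier G \<Longrightarrow> set vs \<subseteq> carrier G \<Longrightarrow>
    foldr (\<otimes>) (us @ vs) \<one> = foldr (\<otimes>) us \<one> \<otimes> foldr (\<otimes>) vs \<one>"
  by (induction us) (auto simp: foldr_mult_closed m_assoc)

lemma generate_imp_word:
  assumes "S \<subseteq> carrier G" "g \<in> generate G S"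
  shows "\<exists>ws. set ws \<subseteq> S \<union> m_inv G ` S \<and> g = foldr (\<otimes>) ws \<one>"
  using assms(2)
proof induction
  case one
  show ?case by (intro exI[of _ "[]"]) simp
next
  case (incl h)
  then show ?case using assms(1) by (intro exI[of _ "[h]"]) auto
next
  case (inv h)
  then show ?case using assms(1) by (intro exI[of _ "[inv h]"]) auto
next
  case (eng g h)
  then obtain us vs where "set us \<subseteq> S \<union> m_inv G ` S" "g = foldr (\<otimes>) us \<one>"
    "set vs \<subseteq> S \<union> m_inv G ` S" "h = foldr (\<otimes>) vs \<one>" by blast
  moreover from this have "foldr (\<otimes>) (us @ vs) \<one> = foldr (\<otimes>) us \<one> \<otimes> foldr (\<otimes>) vs \<one>"
    using assms(1) by (intro foldr_mult_append) auto
  ultimately show ?case by (intro exI[of _ "us @ vs"]) (simp del: foldr_append)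
qed

text \<open>
  Word length is defined by a \<open>LEAST\<close>, so this rests on the generating property: it ensures that
  the minimum is attained for every element of the group.
\<close>

lemma word_ball_eq_image_words:
  assumes S: "S \<subseteq> carrier G" "generate G S = carrier G"
  shows "word_ball G S n = (\<lambda>ws. foldr (\<otimes>) ws \<one>) ` words G S n"
proof -
  have T: "S \<union> m_inv G ` S \<subseteq> carrier G" using S(1) by auto
  have "g \<in> carrier G \<and> word_dist G S \<one> g \<le> n \<longleftrightarrow> (\<exists>ws \<in> words G S n. g = foldr (\<otimes>) ws \<one>)"
    (is "?ball g \<longleftrightarrow> ?word g") for g
  proof
    assume ball: "?ball g"
    then have "\<exists>k ws. length ws = k \<and> set ws \<subseteq> S \<union> m_inv G ` S \<and> g = foldr (\<otimes>) ws \<one>"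
      using generate_imp_word[OF S(1), of g] S(2) by auto
    then have "\<exists>ws. length ws = word_length G S g \<and> set ws \<subseteq> S \<union> m_inv G ` S \<and> g = foldr (\<otimes>) ws \<one>"
      unfolding word_length_def by (rule LeastI_ex)
    moreover have "word_length G S g \<le> n" using ball by (auto simp: word_dist_def)
    ultimately show "?word g" unfolding words_def by auto
  next
    assume "?word g"
    then obtain ws where ws: "set ws \<subseteq> S \<union> m_inv G ` S" "length ws \<le> n" "g = foldr (\<otimes>) ws \<one>"
      by (auto simp: words_def)
    then have "g \<in> carrier G" using T foldr_mult_closed by blast
    moreover have "word_length G S g \<le> length ws"
      unfolding word_length_def using ws by (intro Least_le) blast
    ultimately show "?ball g" using ws(2) by (simp add: word_dist_def)
  qed
  then show ?thesis unfolding word_ball_def by blast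
qed

end

lemma sum_powers_le_power_Suc: "(\<Sum>i\<le>n. t ^ i) \<le> (Suc t) ^ n" for t :: nat
proof (induction n)
  case (Suc n)
  have "t ^ Suc n \<le> t * Suc t ^ n" by (simp add: power_mono mult_le_mono2)
  then show ?case using add_mono[OF Suc] by simp
qed simp

locale word_metric = group +
  fixes S
  assumes finite_gens: "finite S" and gens_closed: "S \<subseteq> carrier G"
    and generates: "generate G S = carrier G"
begin

lemmas ball_eq = word_ball_eq_image_words[OF gens_closed generates]

lemma ball_mono: "m \<le> n \<Longrightarrow> word_ball G S m \<subseteq> word_ball G S n"
  by (auto simp: word_ball_def)

lemma in_some_ball: "x \<in> carrier G \<Longrightarrow> \<exists>n. x \<in> word_ball G S n"
  by (auto simp: word_ball_def)

lemma finite_subset_ball: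
  assumes "finite X" "X \<subseteq> carrier G"
  shows "\<exists>n. X \<subseteq> word_ball G S n"
proof (intro exI subsetI)
  fix x assume "x \<in> X"
  then show "x \<in> word_ball G S (Max (word_dist G S \<one> ` X))"
    using assms by (auto simp: word_ball_def)
qed

lemma ball_mult:
  assumes "x \<in> word_ball G S m" "y \<in> word_ball G S n"
  shows "x \<otimes> y \<in> word_ball G S (m + n)"
proof -
  obtain us vs where uv: "us \<in> words G S m" "vs \<in> words G S n"
    "x = foldr (\<otimes>) us \<one>" "y = foldr (\<otimes>) vs \<one>"
    using assms by (auto simp: ball_eq)
  moreover have "S \<union> m_inv G ` S \<subseteq> carrier G" using gens_closed by auto
  ultimately have "x \<otimes> y = foldr (\<otimes>) (us @ vs) \<one>"
    by (subst foldr_mult_append) (auto simp: words_def)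
  moreover have "us @ vs \<in> words G S (m + n)" using uv by (auto simp: words_def)
  ultimately show ?thesis unfolding ball_eq by (rule image_eqI)
qed

lemma finite_ball: "finite (word_ball G S n)"
  unfolding ball_eq words_def using finite_gens by (intro finite_imageI finite_lists_length_le) auto

lemma card_ball_le: "card (word_ball G S n) \<le> Suc (card (S \<union> m_inv G ` S)) ^ n"
proof -
  let ?T = "S \<union> m_inv G ` S"
  have T: "finite ?T" using finite_gens by simp
  have "card (word_ball G S n) \<le> card (words G S n)"
    unfolding ball_eq words_def using T by (intro card_image_le finite_lists_length_le)
  also have "\<dots> = (\<Sum>i\<le>n. card ?T ^ i)"
    unfolding words_def using T by (rule card_lists_length_le)
  also have "\<dots> \<le> Suc (card ?T) ^ n" by (rule sum_powers_le_power_Suc)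
  finally show ?thesis .
qed

section \<open>Growth of approximate semigroups\<close>

text \<open>
  The factor \<open>a\<close> in \<open>u v = a x\<close> is recovered as \<open>u v x\<^sup>-\<^sup>1\<close>, which bounds its length; the pairs
  \<open>(a, x)\<close> therefore range over a set of the stated size.
\<close>

lemma card_product_le:
  assumes A: "A \<subseteq> carrier G" and X: "finite X" "X \<subseteq> carrier G" "A <#> A \<subseteq> A <#> X"
    and c: "m_inv G ` X \<subseteq> word_ball G S c"
  shows "card ((A \<inter> word_ball G S n) <#> (A \<inter> word_ball G S k))
    \<le> card (A \<inter> word_ball G S (n + k + c)) * card X"
proof -
  let ?Z = "A \<inter> word_ball G S (n + k + c)"
  have "(A \<inter> word_ball G S n) <#> (A \<inter> word_ball G S k) \<subseteq> (\<lambda>(a, x). a \<otimes> x) ` (?Z \<times> X)"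
  proof
    fix z assume "z \<in> (A \<inter> word_ball G S n) <#> (A \<inter> word_ball G S k)"
    then obtain u v where uv: "z = u \<otimes> v" "u \<in> A" "v \<in> A" "u \<in> word_ball G S n" "v \<in> word_ball G S k"
      by (auto simp: set_mult_def)
    then have "z \<in> A <#> A" by (auto simp: set_mult_def)
    then have "z \<in> A <#> X" using X(3) by auto
    then obtain a x where ax: "a \<in> A" "x \<in> X" "z = a \<otimes> x" by (auto simp: set_mult_def)
    then have "a = z \<otimes> inv x" using A X(2) by (auto simp: m_assoc subset_iff)
    moreover have "z \<otimes> inv x \<in> word_ball G S (n + k + c)"
      using uv ball_mult c ax(2) by blast
    ultimately show "z \<in> (\<lambda>(a, x). a \<otimes> x) ` (?Z \<times> X)" using ax by auto
  qed
  then have "card ((A \<inter> word_ball G S n) <#> (A \<inter> word_ball G S k)) \<le> card (?Z \<times> X)"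
    using X(1) finite_ball by (intro surj_card_le) auto
  then show ?thesis by (simp add: card_cartesian_product)
qed

end

theorem theorem4p2:
  fixes G :: "('a, 'b) monoid_scheme" and S A :: "'a set" and f :: "nat \<Rightarrow> real"
  assumes "group G"
    and "finite S" and "S \<subseteq> carrier G" and "generate G S = carrier G"
    and "mono f" and "\<And>n. f n \<ge> 1"
    and "product_shrinkage_at_most G S f"
    and "summable (\<lambda>n. ln (f (Suc n)) / (real (Suc n))\<^sup>2)"
    and "approximate_semigroup G A" and "A \<noteq> {}"
  shows "\<exists>L::real. (\<lambda>n. 1 / real n * ln (real (card (A \<inter> word_ball G S n)))) \<longlonglongrightarrow> L"
proof -
  interpret word_metric G S
    using assms(1-4) by (simp add: word_metric_def word_metric_axioms_def)
  obtain X where X: "finite X" "X \<subseteq> carrier G" "A <#>\<^bsub>G\<^esub> A \<subseteq> A <#>\<^bsub>G\<^esub> X" and A: "A \<subseteq> carrier G"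
    using assms(9) by (auto simp: approximate_semigroup_def)
  obtain x0 where x0: "x0 \<in> A" using assms(10) by auto
  have "X \<noteq> {}" using X(3) x0 by (auto simp: set_mult_def)
  then have X1: "1 \<le> real (card X)" using X(1) by (simp add: Suc_leI card_gt_0_iff)
  have "finite (m_inv G ` X)" "m_inv G ` X \<subseteq> carrier G" using X by auto
  then obtain c where c: "m_inv G ` X \<subseteq> word_ball G S c" using finite_subset_ball by blast
  obtain n0 where n0: "x0 \<in> word_ball G S n0" using in_some_ball A x0 by blast
  define a where "a n = card (A \<inter> word_ball G S n)" for n
  define b where "b n = ln (real (a n))" for n
  have fin: "finite (A \<inter> word_ball G S n)" for n using finite_ball by simp
  have a_mono: "a m \<le> a n" if "m \<le> n" for m n
    unfolding a_def using ball_mono[OF that] by (intro card_mono fin) auto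
  have a_pos: "1 \<le> a n" if "n0 \<le> n" for n
  proof -
    have "0 < a n0" unfolding a_def using x0 n0 fin by (subst card_gt_0_iff) blast
    then show ?thesis using a_mono[OF that] by simp
  qed
  have b_nonneg: "0 \<le> b n" for n by (cases "a n = 0") (auto simp: b_def)
  \<comment> \<open>For empty \<open>A \<inter> word_ball G S m\<close> this uses the convention \<open>ln 0 = 0\<close>.\<close>
  have b_mono: "b m \<le> b n" if "m \<le> n" for m n
    using a_mono[OF that] b_nonneg[of n] by (cases "a m = 0") (auto simp: b_def)
  have b_le: "b n \<le> ln (Suc (card (S \<union> m_inv G ` S))) * n" for n
  proof (cases "a n = 0")
    case False
    have "a n \<le> card (word_ball G S n)" unfolding a_def by (intro card_mono finite_ball) auto
    then have "a n \<le> Suc (card (S \<union> m_inv G ` S)) ^ n" using card_ball_le[of n] by simp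
    then have "real (a n) \<le> real (Suc (card (S \<union> m_inv G ` S))) ^ n" by (metis of_nat_le_iff of_nat_power)
    then have "b n \<le> ln (real (Suc (card (S \<union> m_inv G ` S))) ^ n)"
      unfolding b_def using False by (intro ln_mono) auto
    then show ?thesis by (simp add: ln_realpow mult.commute del: of_nat_Suc)
  qed (simp add: b_def)
  have b_super: "b n + b k \<le> b (n + k + c) + (ln (card X) + ln (f (n + k)))" if nk: "n0 \<le> n" "n0 \<le> k" for n k
  proof -
    have pos: "0 < real (a n)" "0 < real (a k)" "0 < real (a (n + k + c))" "0 < f (n + k)" "0 < real (card X)"
      using a_pos[of n] a_pos[of k] a_pos[of "n + k + c"] nk assms(6)[of "n + k"] X1 by simp_all
    have "real (a n) * a k / f (n + k) \<le> card ((A \<inter> word_ball G S n) <#>\<^bsub>G\<^esub> (A \<inter> word_ball G S k))"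
      using assms(7) fin unfolding product_shrinkage_at_most_def a_def by blast
    also have "\<dots> \<le> real (a (n + k + c) * card X)"
      unfolding a_def using card_product_le[OF A X c] by (simp del: of_nat_mult)
    finally have "real (a n) * a k \<le> a (n + k + c) * (card X * f (n + k))"
      using pos by (simp add: field_simps)
    then have "ln (real (a n) * a k) \<le> ln (a (n + k + c) * (card X * f (n + k)))"
      using pos by (intro ln_mono) auto
    then show ?thesis using pos unfolding b_def by (simp add: ln_mult_pos)
  qed
  \<comment> \<open>Delaying by \<open>c\<close> absorbs the extra \<open>c\<close> in the radius: both summands together bring a delay of
    \<open>2c\<close>, of which \<open>b_super\<close> consumes only one \<open>c\<close>.\<close>
  define d where "d n = b (n - c)" for n
  define g where "g n = ln (card X) + ln (f n)" for n
  have f_pos: "0 < f n" for n using assms(6)[of n] by simp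
  have "convergent (\<lambda>n. d n / n)"
  proof (rule almost_superadditive_convergent)
    show "mono d" by (intro monoI) (simp add: d_def b_mono)
    show "0 \<le> d n" for n by (simp add: d_def b_nonneg)
    show "d n \<le> ln (Suc (card (S \<union> m_inv G ` S))) * n" for n
      using b_mono[of "n - c" n] b_le[of n] by (simp add: d_def)
    show "mono g" using assms(5) f_pos by (intro monoI) (simp add: g_def monoD)
    show "0 \<le> g n" for n using X1 assms(6)[of n] by (simp add: g_def)
    have "summable (\<lambda>n. ln (f n) / (real n)\<^sup>2)"
      using assms(8) by (subst (asm) summable_Suc_iff)
    moreover have "summable (\<lambda>n. ln (card X) * inverse (real n ^ 2))"
      by (intro summable_mult inverse_power_summable) simp
    ultimately show "summable (\<lambda>n. g n / (real n)\<^sup>2)"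
      unfolding g_def divide_inverse distrib_right by (rule summable_add[rotated])
    show "d p + d q \<le> d (p + q) + g (p + q)" if "n0 + c \<le> p" "n0 + c \<le> q" for p q
    proof -
      have "b (p - c) + b (q - c) \<le> b (p - c + (q - c) + c) + (ln (card X) + ln (f (p - c + (q - c))))"
        using that by (intro b_super) auto
      moreover have "p - c + (q - c) + c = p + q - c" using that by simp
      moreover have "ln (f (p - c + (q - c))) \<le> ln (f (p + q))"
        using f_pos assms(5) by (simp add: monoD)
      ultimately show ?thesis by (simp add: d_def g_def)
    qed
  qed
  then obtain L where "(\<lambda>n. d n / n) \<longlonglongrightarrow> L" by (auto simp: convergent_def)
  then have "(\<lambda>n. d (n + c) / real (n + c)) \<longlonglongrightarrow> L" by (rule LIMSEQ_ignore_initial_segment)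
  moreover have "(\<lambda>n. real (n + c) / real n) \<longlonglongrightarrow> 1"
  proof -
    have "(\<lambda>n. 1 + real c / real n) \<longlonglongrightarrow> 1 + 0"
      by (intro tendsto_intros lim_const_over_n)
    moreover have "\<forall>\<^sub>F n in sequentially. 1 + real c / real n = real (n + c) / real n"
      using eventually_gt_at_top[of 0] by eventually_elim (simp add: field_simps)
    ultimately have "(\<lambda>n. real (n + c) / real n) \<longlonglongrightarrow> 1 + 0"
      by (rule Lim_transform_eventually)
    then show ?thesis by simp
  qed
  ultimately have lim: "(\<lambda>n. d (n + c) / real (n + c) * (real (n + c) / real n)) \<longlonglongrightarrow> L * 1"
    by (rule tendsto_mult)
  have "\<forall>\<^sub>F n in sequentially. d (n + c) / real (n + c) * (real (n + c) / real n) = 1 / real n * b n"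
    using eventually_gt_at_top[of 0] by eventually_elim (simp add: d_def)
  with lim have "(\<lambda>n. 1 / real n * b n) \<longlonglongrightarrow> L * 1"
    by (rule Lim_transform_eventually)
  then show ?thesis unfolding b_def a_def by blast
qed

end
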